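(* For every real number $\varepsilon>0$ there exists $n_0=n_0(\varepsilon)$ such that for every integer $n\ge n_0$ the following holds. If $a,b$ are positive integers with $a\le \ln n$ and $b\ge (1+\varepsilon)\frac{an}{\ln(an)}$, then the $(a:b)$ Maker-Breaker Connectivity game $\mathcal{T}_n$ is Breaker's win.
   Context: In the $(a:b)$ Maker-Breaker Connectivity game $\mathcal{T}_n$, the board is the edge set of the complete graph $K_n$. Two players, Maker and Breaker, alternately claim previously unclaimed edges, Breaker going first; in each turn Breaker claims $b$ edges and then Maker claims $a$ edges, until every edge is claimed (in the final turn a player claims all remaining edges if fewer are left). Maker wins if, by the end of the game, the graph of his edges is a connected spanning subgraph of $K_n$; otherwise Breaker wins. The game is Breaker's win if Breaker has a strategy that wins against every strategy of Maker. $\ln$ denotes the natural logarithm. *)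

theory Defs
  imports Complex_Main
begin

text \<open>A player's strategy maps the history of the game, i.e. the list of the edge sets claimed
  in the successive turns so far, to the set of edges the player claims next.\<close>

type_synonym 'e strategy = "'e set list \<Rightarrow> 'e set"

definition free_edges :: "'e set \<Rightarrow> 'e set list \<Rightarrow> 'e set" where
  "free_edges E h = E - \<Union> (set h)"

text \<open>A strategy with bias \<open>q\<close> claims \<open>q\<close> free edges per turn, or all of them if fewer are left.
  The requirement is imposed on all histories; this is no restriction, since on histories that
  cannot occur in the game it can always be met and is irrelevant.\<close>

definition legal_strategy :: "'e set \<Rightarrow> nat \<Rightarrow> 'e strategy \<Rightarrow> bool" where
  "legal_strategy E q s \<longleftrightarrow>
     (\<forall>h. s h \<subseteq> free_edges E h \<and> card (s h) = min q (card (free_edges E h)))"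

text \<open>\<open>play \<sigma> \<tau> t\<close> is the history after \<open>t\<close> turns; Breaker (\<open>\<sigma>\<close>) moves in the even turns
  \<open>0, 2, \<dots>\<close> and Maker (\<open>\<tau>\<close>) in the odd ones.  Once the finite board is exhausted,
  legal moves are empty, so running the play forever does not change the outcome.\<close>

fun play :: "'e strategy \<Rightarrow> 'e strategy \<Rightarrow> nat \<Rightarrow> 'e set list" where
  "play \<sigma> \<tau> 0 = []"
| "play \<sigma> \<tau> (Suc t) =
     (let h = play \<sigma> \<tau> t in h @ [if even t then \<sigma> h else \<tau> h])"

definition maker_edges :: "'e strategy \<Rightarrow> 'e strategy \<Rightarrow> 'e set" where
  "maker_edges \<sigma> \<tau> = (\<Union>t\<in>{t. odd t}. \<tau> (play \<sigma> \<tau> t))"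

definition complete_graph_edges :: "nat \<Rightarrow> nat set set" where
  "complete_graph_edges n = {e. e \<subseteq> {..<n} \<and> card e = 2}"

definition connected_spanning :: "'v set \<Rightarrow> 'v set set \<Rightarrow> bool" where
  "connected_spanning V M \<longleftrightarrow> (\<forall>u\<in>V. \<forall>v\<in>V. (u, v) \<in> {(x, y). {x, y} \<in> M}\<^sup>*)"

definition breaker_wins_connectivity :: "nat \<Rightarrow> nat \<Rightarrow> nat \<Rightarrow> bool" where
  "breaker_wins_connectivity a b n \<longleftrightarrow>
     (\<exists>\<sigma>. legal_strategy (complete_graph_edges n) b \<sigma> \<and>
       (\<forall>\<tau>. legal_strategy (complete_graph_edges n) a \<tau> \<longrightarrow>
          \<not> connected_spanning {..<n} (maker_edges \<sigma> \<tau>)))"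

end

theory Submission
  imports Defs "HOL-Real_Asymp.Real_Asymp"
begin

text \<open>Breaker first builds a clique of about \<open>a n / (ln n)\<^sup>4\<close> vertices that Maker has not touched: he
  keeps adding \<open>a + 1\<close> untouched vertices at once, and as Maker's edges cannot lie inside the
  clique, Maker spoils at most \<open>a\<close> clique vertices per turn.  The stars of the clique vertices
  then have disjoint sets of free edges, and Breaker plays the box game on them: he
  shrinks all surviving stars evenly while Maker destroys at most \<open>a\<close> stars per turn.  With
  \<open>a i + 1\<close> stars left every star loses about \<open>b / (a i + 1)\<close> edges, so in total the last star
  loses about \<open>(b / a) ln n\<close> edges, which exceeds \<open>n\<close>.\<close>

section \<open>Positional wins\<close>

text \<open>\<open>forced_win E F a b B M\<close>: with Breaker to move, \<open>B\<close> and \<open>M\<close> being the edges claimed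
  so far, Breaker can claim a whole member of \<open>F\<close>.  Breaker may claim fewer than \<open>b\<close> edges here.\<close>

inductive forced_win :: "'e set \<Rightarrow> 'e set set \<Rightarrow> nat \<Rightarrow> nat \<Rightarrow> 'e set \<Rightarrow> 'e set \<Rightarrow> bool"
  for E F a b where
  filled: "A \<in> F \<Longrightarrow> A \<subseteq> B \<Longrightarrow> forced_win E F a b B M"
| turn: "S \<subseteq> E - (B \<union> M) \<Longrightarrow> card S \<le> b \<Longrightarrow>
    (\<And>T. T \<subseteq> E - (B \<union> M \<union> S) \<Longrightarrow> card T \<le> a \<Longrightarrow> forced_win E F a b (B \<union> S) (M \<union> T)) \<Longrightarrow>
    forced_win E F a b B M"

text \<open>Extra edges never hurt Breaker: he follows the same plan, omitting from each move the
  edges he already owns. Maker's possible replies in the larger position are among those the plan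
  already covers.\<close>

lemma forced_win_mono:
  assumes "forced_win E F a b B M" "finite E" "B \<subseteq> B'" "B' \<inter> M = {}"
  shows "forced_win E F a b B' M"
  using assms(1,3,4)
proof (induction arbitrary: B')
  case (filled A B M)
  then show ?case by (meson forced_win.filled order_trans)
next
  case (turn S B M)
  show ?case
  proof (rule forced_win.turn[where S = "S - B'"])
    show "S - B' \<subseteq> E - (B' \<union> M)"
      using turn.hyps(1) by blast
    have "finite S"
      using turn.hyps(1) \<open>finite E\<close> finite_subset by blast
    then show "card (S - B') \<le> b"
      using turn.hyps(2) by (meson Diff_subset card_mono order_trans)
    fix T assume T: "T \<subseteq> E - (B' \<union> M \<union> (S - B'))" "card T \<le> a"
    show "forced_win E F a b (B' \<union> (S - B')) (M \<union> T)"
      by (rule turn.IH) (use T turn.prems turn.hyps(1) in auto)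
  qed
qed

text \<open>On a full board only empty moves exist, so following the empty reply leads down to a
  \<open>filled\<close> leaf without changing \<open>B\<close>. This reads off the outcome at the
  end of a play.\<close>

lemma forced_win_exhausted:
  assumes "forced_win E F a b B M" "E \<subseteq> B \<union> M"
  shows "\<exists>A\<in>F. A \<subseteq> B"
  using assms
proof induction
  case (turn S B M)
  have "S = {}"
    using turn.hyps(1) turn.prems by blast
  with turn.IH[of "{}"] turn.prems show ?case by auto
qed blast

text \<open>Bridges the gap between the positional game, where Breaker may claim fewer than
  \<open>b\<close> edges, and legal strategies, which must use the full bias: a winning move is
  padded with arbitrary free edges, harmless by \<open>forced_win_mono\<close>.\<close>

lemma forced_win_full_turn:
  assumes "forced_win E F a b B M" "finite E" "B \<inter> M = {}"
  shows "\<exists>S\<subseteq>E - (B \<union> M). card S = min b (card (E - (B \<union> M))) \<and>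
    (\<forall>T. T \<subseteq> E - (B \<union> M \<union> S) \<longrightarrow> card T \<le> a \<longrightarrow> forced_win E F a b (B \<union> S) (M \<union> T))"
proof -
  have fin: "finite (E - (B \<union> M))"
    using \<open>finite E\<close> by blast
  obtain S where S: "S \<subseteq> E - (B \<union> M)" "card S \<le> b"
    "\<And>T. T \<subseteq> E - (B \<union> M \<union> S) \<Longrightarrow> card T \<le> a \<Longrightarrow> forced_win E F a b (B \<union> S) (M \<union> T)"
    using assms(1)
  proof cases
    case (filled A)
    \<comment> \<open>A filled winning set stays filled whatever Maker claims, so the empty move
      serves as a winning move before padding.\<close>
    show thesis
      by (rule that[of "{}"]) (use filled in \<open>auto intro: forced_win.filled\<close>)
  next
    case (turn S)
    then show thesis by (rule that)
  qed
  have "card S \<le> min b (card (E - (B \<union> M)))"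
    using S fin by (simp add: card_mono)
  then obtain S' where S': "S \<subseteq> S'" "S' \<subseteq> E - (B \<union> M)" "card S' = min b (card (E - (B \<union> M)))"
    using exists_subset_between[OF _ _ S(1) fin] by (metis min.cobounded2)
  have "forced_win E F a b (B \<union> S') (M \<union> T)" if T: "T \<subseteq> E - (B \<union> M \<union> S')" "card T \<le> a" for T
    by (rule forced_win_mono[OF S(3) \<open>finite E\<close>]) (use T S' assms(3) in auto)
  with S' show ?thesis by blast
qed

section \<open>From positional wins to strategies\<close>

text \<open>A strategy sees only the history, so ownership is recovered from turn parity:
  \<open>even\<close> selects Breaker's edges, \<open>odd\<close> Maker's.\<close>

definition claimed :: "(nat \<Rightarrow> bool) \<Rightarrow> 'e set list \<Rightarrow> 'e set" where
  "claimed P h = (\<Union>i\<in>{i. i < length h \<and> P i}. h ! i)"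

lemma claimed_Nil [simp]: "claimed P [] = {}"
  by (simp add: claimed_def)

lemma claimed_snoc:
  "claimed P (h @ [x]) = (if P (length h) then claimed P h \<union> x else claimed P h)"
proof -
  have "{i. i < length (h @ [x]) \<and> P i} =
    {i. i < length h \<and> P i} \<union> (if P (length h) then {length h} else {})"
    by (auto simp: less_Suc_eq)
  then show ?thesis
    by (auto simp: claimed_def nth_append)
qed

lemma free_edges_claimed: "free_edges E h = E - (claimed even h \<union> claimed odd h)"
proof -
  have "\<Union> (set h) = claimed even h \<union> claimed odd h"
    unfolding claimed_def set_conv_nth by blast
  then show ?thesis
    by (simp add: free_edges_def)
qed

lemma length_play [simp]: "length (play \<sigma> \<tau> t) = t"
  by (induction t) (auto simp: Let_def)

lemma set_play_mono: "s \<le> t \<Longrightarrow> set (play \<sigma> \<tau> s) \<subseteq> set (play \<sigma> \<tau> t)"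
  by (induction t rule: dec_induct) (auto simp: Let_def)

lemma claimed_play_mono: "s \<le> t \<Longrightarrow> claimed P (play \<sigma> \<tau> s) \<subseteq> claimed P (play \<sigma> \<tau> t)"
  by (induction t rule: dec_induct) (auto simp: Let_def claimed_snoc)

text \<open>Both biases are positive, so every turn on a non-full board uses up an edge. By
  truncated subtraction the bound is 0 from turn \<open>card E\<close> on.\<close>

lemma card_free_edges_play:
  assumes "finite E" "legal_strategy E b \<sigma>" "legal_strategy E a \<tau>" "0 < a" "0 < b"
  shows "card (free_edges E (play \<sigma> \<tau> t)) \<le> card E - t"
proof (induction t)
  case (Suc t)
  define h where "h = play \<sigma> \<tau> t"
  define X where "X = (if even t then \<sigma> h else \<tau> h)"
  define q where "q = (if even t then b else a)"
  have X: "X \<subseteq> free_edges E h" "card X = min q (card (free_edges E h))" "0 < q"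
    using assms by (auto simp: X_def q_def legal_strategy_def)
  have fin: "finite (free_edges E h)"
    using \<open>finite E\<close> by (simp add: free_edges_def)
  have "free_edges E (play \<sigma> \<tau> (Suc t)) = free_edges E h - X"
    by (auto simp: free_edges_def Let_def X_def h_def)
  then have "card (free_edges E (play \<sigma> \<tau> (Suc t))) = card (free_edges E h) - card X"
    using X(1) fin by (simp add: card_Diff_subset finite_subset)
  with X(2,3) Suc.IH show ?case
    by (auto simp: h_def)
qed (simp add: free_edges_def)

text \<open>Breaker picks at each history a full-size move that keeps the position winning. The
  invariant holds before each of his turns, and once the board is exhausted a winning position means
  a filled set.\<close>

theorem forced_win_strategy:
  assumes win: "forced_win E F a b {} {}" and "finite E" "0 < a" "0 < b"
  shows "\<exists>\<sigma>. legal_strategy E b \<sigma> \<and>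
    (\<forall>\<tau>. legal_strategy E a \<tau> \<longrightarrow> (\<exists>A\<in>F. A \<inter> maker_edges \<sigma> \<tau> = {}))"
proof -
  define good where "good h \<longleftrightarrow>
    forced_win E F a b (claimed even h) (claimed odd h) \<and> claimed even h \<inter> claimed odd h = {}"
    for h
  \<comment> \<open>Legality is imposed on all histories, so a move must exist even where
    \<open>good\<close> fails; there only its size and freeness are required.\<close>
  define move where "move h S \<longleftrightarrow>
    S \<subseteq> free_edges E h \<and> card S = min b (card (free_edges E h)) \<and>
    (good h \<longrightarrow> (\<forall>T. T \<subseteq> free_edges E h - S \<longrightarrow> card T \<le> a \<longrightarrow>
      forced_win E F a b (claimed even h \<union> S) (claimed odd h \<union> T)))" for h S
  have "\<exists>S. move h S" for h
  proof (cases "good h")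
    case True
    have "E - (B \<union> M \<union> S) = E - (B \<union> M) - S" for B M S :: "'a set" by blast
    then show ?thesis
      using forced_win_full_turn[of E F a b "claimed even h" "claimed odd h"] True \<open>finite E\<close>
      unfolding move_def good_def free_edges_claimed by simp
  next
    case False
    then show ?thesis
      unfolding move_def by (meson min.cobounded2 obtain_subset_with_card_n)
  qed
  then obtain \<sigma> where \<sigma>: "\<And>h. move h (\<sigma> h)" by metis
  have legal: "legal_strategy E b \<sigma>"
    using \<sigma> by (simp add: legal_strategy_def move_def)
  have "\<exists>A\<in>F. A \<inter> maker_edges \<sigma> \<tau> = {}" if \<tau>: "legal_strategy E a \<tau>" for \<tau>
  proof -
    have good: "good (play \<sigma> \<tau> (2 * r))" for r
    proof (induction r)
      case 0
      then show ?case using win by (simp add: good_def)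
    next
      case (Suc r)
      define h where "h = play \<sigma> \<tau> (2 * r)"
      define T where "T = \<tau> (h @ [\<sigma> h])"
      have play: "play \<sigma> \<tau> (2 * Suc r) = (h @ [\<sigma> h]) @ [T]"
        by (simp add: h_def T_def Let_def)
      have len: "length h = 2 * r"
        by (simp add: h_def)
      have "T \<subseteq> free_edges E (h @ [\<sigma> h])" "card T \<le> a"
        using \<tau> by (simp_all add: legal_strategy_def T_def)
      then have T: "T \<subseteq> free_edges E h - \<sigma> h" "card T \<le> a"
        by (auto simp: free_edges_def)
      have S: "\<sigma> h \<subseteq> free_edges E h"
        using \<sigma>[of h] by (simp add: move_def)
      have "forced_win E F a b (claimed even h \<union> \<sigma> h) (claimed odd h \<union> T)"
        using \<sigma>[of h] Suc.IH T by (simp add: move_def h_def)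
      moreover have "(claimed even h \<union> \<sigma> h) \<inter> (claimed odd h \<union> T) = {}"
        using S T Suc.IH by (auto simp: free_edges_claimed good_def h_def)
      ultimately show ?case
        unfolding play by (simp add: good_def claimed_snoc len del: append_assoc)
    qed
    \<comment> \<open>An even turn number, so that the invariant applies, and late enough for the
      board to be full.\<close>
    define N where "N = 2 * card E"
    define h where "h = play \<sigma> \<tau> N"
    have "card (free_edges E h) = 0"
      using card_free_edges_play[OF \<open>finite E\<close> legal \<tau> \<open>0 < a\<close> \<open>0 < b\<close>, of N]
      by (simp add: h_def N_def)
    then have exh: "free_edges E h = {}"
      using \<open>finite E\<close> by (simp add: free_edges_def)
    have gh: "good h"
      unfolding h_def N_def by (rule good)
    then obtain A where A: "A \<in> F" "A \<subseteq> claimed even h"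
      using forced_win_exhausted[of E F a b "claimed even h" "claimed odd h"] exh
      by (auto simp: good_def free_edges_claimed)
    have "maker_edges \<sigma> \<tau> \<subseteq> claimed odd h"
    proof
      fix e assume "e \<in> maker_edges \<sigma> \<tau>"
      then obtain t where t: "odd t" "e \<in> \<tau> (play \<sigma> \<tau> t)"
        by (auto simp: maker_edges_def)
      then have free: "e \<in> free_edges E (play \<sigma> \<tau> t)"
        using \<tau> by (auto simp: legal_strategy_def)
      have "t < N"
      proof (rule ccontr)
        assume "\<not> t < N"
        then have "free_edges E (play \<sigma> \<tau> t) \<subseteq> free_edges E h"
          using set_play_mono[of N t \<sigma> \<tau>] by (auto simp: free_edges_def h_def)
        with free exh show False by blast
      qed
      then have "claimed odd (play \<sigma> \<tau> (Suc t)) \<subseteq> claimed odd h"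
        unfolding h_def by (intro claimed_play_mono) simp
      moreover have "e \<in> claimed odd (play \<sigma> \<tau> (Suc t))"
        using t by (simp add: Let_def claimed_snoc)
      ultimately show "e \<in> claimed odd h" by blast
    qed
    with A gh show ?thesis
      by (auto simp: good_def)
  qed
  with legal show ?thesis by blast
qed

section \<open>Stars and untouched cliques\<close>

definition star :: "nat \<Rightarrow> nat \<Rightarrow> nat set set" where
  "star n v = {e \<in> complete_graph_edges n. v \<in> e}"

text \<open>All edges inside \<open>C\<close> belong to Breaker and no Maker edge meets
  \<open>C\<close>. Hence a free edge has at most one end in \<open>C\<close>, and every edge at a
  vertex of \<open>C\<close> is Breaker's or free. The empty set qualifies, which starts the first
  stage.\<close>

definition untouched_clique :: "nat \<Rightarrow> nat set \<Rightarrow> nat set set \<Rightarrow> nat set set \<Rightarrow> bool" where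
  "untouched_clique n C B M \<longleftrightarrow>
     C \<subseteq> {..<n} \<and> (\<forall>e. e \<subseteq> C \<longrightarrow> card e = 2 \<longrightarrow> e \<in> B) \<and> C \<inter> \<Union>M = {}"

lemma finite_complete_graph_edges [simp]: "finite (complete_graph_edges n)"
  by (rule finite_subset[of _ "Pow {..<n}"]) (auto simp: complete_graph_edges_def)

lemma finite_star [simp]: "finite (star n v)"
  by (simp add: star_def)

lemma card_star_le: "card (star n v) \<le> n"
proof -
  have "star n v \<subseteq> (\<lambda>u. {u, v}) ` {..<n}"
    by (auto simp: star_def complete_graph_edges_def card_2_iff)
  then show ?thesis
    by (metis card_image_le card_lessThan card_mono finite_imageI finite_lessThan order_trans)
qed

lemma isolated_not_connected:
  assumes "v < n" "2 \<le> n" "star n v \<inter> M = {}" "M \<subseteq> complete_graph_edges n"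
  shows "\<not> connected_spanning {..<n} M"
proof
  assume conn: "connected_spanning {..<n} M"
  obtain u where u: "u < n" "u \<noteq> v"
    using \<open>2 \<le> n\<close> by (cases "v = 0") (auto intro: that[of 0] that[of 1])
  have "(v, u) \<in> {(x, y). {x, y} \<in> M}\<^sup>*"
    using conn u(1) assms(1) by (auto simp: connected_spanning_def)
  then obtain y where "{v, y} \<in> M"
    using u(2) by (cases rule: converse_rtranclE) auto
  then show False
    using assms(3,4) by (auto simp: star_def)
qed

text \<open>A Maker edge avoids \<open>B\<close>, so it cannot have both ends in \<open>C\<close>
  and touches at most one of its vertices. Discarding the at most \<open>a\<close> touched vertices
  leaves room for \<open>k\<close>.\<close>

lemma untouched_clique_after_maker_turn:
  assumes cl: "untouched_clique n C B M" and T: "T \<subseteq> complete_graph_edges n - B" "card T \<le> a"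
    and k: "k + a \<le> card C"
  shows "\<exists>C'\<subseteq>C. card C' = k \<and> untouched_clique n C' B (M \<union> T)"
proof -
  have fin: "finite C" "finite T"
    using cl T(1) by (auto simp: untouched_clique_def intro: finite_subset)
  have "card (e \<inter> C) \<le> 1" if "e \<in> T" for e
  proof (rule ccontr)
    assume "\<not> card (e \<inter> C) \<le> 1"
    moreover have e: "card e = 2" "finite e"
      using that T(1) by (auto simp: complete_graph_edges_def dest: finite_subset)
    ultimately have "e \<inter> C = e"
      by (intro card_seteq) auto
    then show False
      using cl that T(1) e by (auto simp: untouched_clique_def)
  qed
  then have "card (\<Union>e\<in>T. e \<inter> C) \<le> (\<Sum>e\<in>T. 1)"
    using fin by (intro order_trans[OF card_UN_le] sum_mono) auto
  moreover have "(\<Union>e\<in>T. e \<inter> C) = C \<inter> \<Union>T"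
    by blast
  ultimately have "card (C \<inter> \<Union>T) \<le> a"
    using T(2) by simp
  then have "k \<le> card (C - C \<inter> \<Union>T)"
    using k fin by (subst card_Diff_subset) auto
  then obtain C' where "C' \<subseteq> C - C \<inter> \<Union>T" and card: "card C' = k"
    by (meson obtain_subset_with_card_n)
  then have "C' \<subseteq> C" "C' \<inter> \<Union>T = {}"
    by auto
  moreover from this have "untouched_clique n C' B (M \<union> T)"
    using cl unfolding untouched_clique_def by (simp add: Int_Un_distrib) (meson disjoint_iff subset_iff)
  ultimately show ?thesis
    using card by blast
qed

section \<open>The two stages of Breaker's strategy\<close>

text \<open>The winning sets are the stars: owning all edges at a vertex isolates it in Maker's
  graph.\<close>

abbreviation isolates :: "nat \<Rightarrow> nat \<Rightarrow> nat \<Rightarrow> nat set set \<Rightarrow> nat set set \<Rightarrow> bool" where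
  "isolates n \<equiv> forced_win (complete_graph_edges n) (star n ` {..<n})"

text \<open>The stars of \<open>C\<close> are the boxes, each with at most \<open>s\<close> free
  edges. With \<open>a * i + 1\<close> boxes alive Breaker takes \<open>b div (a * i + 1)\<close>
  edges from each, and Maker then ruins at most \<open>a\<close> boxes. The separate summand
  \<open>b\<close> is the last turn, when a single box remains and is taken whole.\<close>

lemma box_stage:
  assumes "untouched_clique n C B M" "card C = a * j + 1"
    and "\<And>v. v \<in> C \<Longrightarrow> card (star n v - B) \<le> s"
    and "s \<le> b + (\<Sum>i=1..j. b div (a * i + 1))"
  shows "isolates n a b B M"
  using assms
proof (induction j arbitrary: C B M s)
  case 0
  then obtain v where v: "C = {v}"
    by (auto simp: card_1_singleton_iff)
  show ?case
  proof (rule turn[where S = "star n v - B"])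
    show "star n v - B \<subseteq> complete_graph_edges n - (B \<union> M)"
      using "0.prems"(1) v by (auto simp: untouched_clique_def star_def)
    show "card (star n v - B) \<le> b"
      using "0.prems"(3)[of v] "0.prems"(4) v by simp
  next
    fix T
    show "isolates n a b (B \<union> (star n v - B)) (M \<union> T)"
      by (rule filled[of "star n v"]) (use "0.prems"(1) v in \<open>auto simp: untouched_clique_def\<close>)
  qed
next
  case (Suc j)
  define q where "q = b div (a * Suc j + 1)"
  have cl: "untouched_clique n C B M"
    by (fact Suc.prems(1))
  have finC: "finite C"
    using cl by (auto simp: untouched_clique_def intro: finite_subset)
  \<comment> \<open>Each box loses \<open>q\<close> edges, or all that are left if fewer; in both
    cases its size drops to at most \<open>s - q\<close>.\<close>
  have "\<exists>R\<subseteq>star n v - B. card R = min q (card (star n v - B))" for v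
    by (meson min.cobounded2 obtain_subset_with_card_n)
  then obtain R where R: "\<And>v. R v \<subseteq> star n v - B" "\<And>v. card (R v) = min q (card (star n v - B))"
    by metis
  show ?case
  proof (rule turn[where S = "\<Union>v\<in>C. R v"])
    show "(\<Union>v\<in>C. R v) \<subseteq> complete_graph_edges n - (B \<union> M)"
      using R(1) cl by (fastforce simp: untouched_clique_def star_def)
    have "card (\<Union>v\<in>C. R v) \<le> (\<Sum>v\<in>C. q)"
      using finC R(2) by (intro order_trans[OF card_UN_le] sum_mono) auto
    also have "\<dots> = (a * Suc j + 1) * (b div (a * Suc j + 1))"
      using Suc.prems(2) by (simp add: q_def)
    also have "\<dots> \<le> b"
      by (rule times_div_less_eq_dividend)
    finally show "card (\<Union>v\<in>C. R v) \<le> b" .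
  next
    fix T
    let ?B = "B \<union> (\<Union>v\<in>C. R v)"
    assume T: "T \<subseteq> complete_graph_edges n - (B \<union> M \<union> (\<Union>v\<in>C. R v))" "card T \<le> a"
    have "untouched_clique n C ?B M"
      using cl by (auto simp: untouched_clique_def)
    moreover have "T \<subseteq> complete_graph_edges n - ?B"
      using T(1) by blast
    moreover have "a * j + 1 + a \<le> card C"
      using Suc.prems(2) by simp
    ultimately obtain C' where C': "C' \<subseteq> C" "card C' = a * j + 1" "untouched_clique n C' ?B (M \<union> T)"
      using untouched_clique_after_maker_turn T(2) by metis
    show "isolates n a b ?B (M \<union> T)"
    proof (rule Suc.IH[OF C'(3,2)])
      show "s - q \<le> b + (\<Sum>i=1..j. b div (a * i + 1))"
        using Suc.prems(4) by (simp add: q_def)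
      fix v assume v: "v \<in> C'"
      have "card (star n v - ?B) \<le> card (star n v - B - R v)"
        using v C'(1) by (intro card_mono) auto
      also have "\<dots> = card (star n v - B) - card (R v)"
        using finite_subset[OF R(1)] R(1) by (intro card_Diff_subset) auto
      also have "\<dots> \<le> s - q"
        using R(2)[of v] Suc.prems(3)[of v] v C'(1) by auto
      finally show "card (star n v - ?B) \<le> s - q" .
    qed
  qed
qed

text \<open>Each round adds \<open>a + 1\<close> vertices and Maker spoils at most \<open>a\<close>,
  so the clique, trimmed to size, grows by exactly one. Thus \<open>card C\<close> counts rounds and
  bounds Maker's edges by \<open>a * card C\<close>; \<open>d\<close> is the number of rounds to go.
  \<open>bias\<close> pays for the new edges of a round, \<open>room\<close> guarantees fresh
  vertices.\<close>

lemma clique_stage: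
  assumes "untouched_clique n C B M" "card C + d = k"
    and "M \<subseteq> complete_graph_edges n" "card M \<le> a * card C"
    and bias: "(a + 1) * (k + a) \<le> b" and room: "(2 * a + 1) * k + a \<le> n"
    and clique_wins: "\<And>C B M. untouched_clique n C B M \<Longrightarrow> card C = k \<Longrightarrow> isolates n a b B M"
  shows "isolates n a b B M"
  using assms(1-4)
proof (induction d arbitrary: C B M)
  case 0
  then show ?case using clique_wins by simp
next
  case (Suc d)
  have cl: "untouched_clique n C B M"
    by (fact Suc.prems(1))
  have finC: "finite C" and finM: "finite M"
    using cl Suc.prems(3) by (auto simp: untouched_clique_def intro: finite_subset)
  have "card (\<Union>M) \<le> (\<Sum>e\<in>M. card e)"
    using finM card_UN_le[of M "\<lambda>e. e"] by simp
  also have "\<dots> = (\<Sum>e\<in>M. 2)"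
    using Suc.prems(3) by (intro sum.cong) (auto simp: complete_graph_edges_def)
  finally have touched: "card (\<Union>M) \<le> 2 * a * card C"
    using Suc.prems(4) by simp
  have "card C + 1 \<le> k"
    using Suc.prems(2) by simp
  then have "(2 * a + 1) * (card C + 1) \<le> (2 * a + 1) * k"
    by (rule mult_le_mono2)
  \<comment> \<open>Maker's edges cover at most \<open>2 * a * card C\<close> vertices, so with
    \<open>C\<close> itself at most \<open>(2 * a + 1) * card C\<close> are excluded.\<close>
  then have "a + 1 + card (C \<union> \<Union>M) \<le> n"
    using room touched card_Un_le[of C "\<Union>M"] by (simp add: algebra_simps)
  moreover have "finite (C \<union> \<Union>M)"
    using finC finM Suc.prems(3) by (auto simp: complete_graph_edges_def intro: finite_subset)
  ultimately have "a + 1 \<le> card ({..<n} - (C \<union> \<Union>M))"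
    using diff_card_le_card_Diff[of "C \<union> \<Union>M" "{..<n}"] by simp
  then obtain D where D: "D \<subseteq> {..<n} - (C \<union> \<Union>M)" "card D = a + 1"
    by (meson obtain_subset_with_card_n)
  have finD: "finite D"
    using D(2) by (intro card_ge_0_finite) simp
  have cardCD: "card (C \<union> D) = card C + a + 1"
    using finC finD D by (subst card_Un_disjoint) auto
  define S where "S = {e. e \<subseteq> C \<union> D \<and> card e = 2} - B"
  show ?case
  proof (rule turn[where S = S])
    show "S \<subseteq> complete_graph_edges n - (B \<union> M)"
    proof
      fix e assume e: "e \<in> S"
      then have "e \<subseteq> C \<union> D" "e \<noteq> {}" "e \<notin> B" "card e = 2"
        by (auto simp: S_def)
      moreover from this have "e \<notin> M"
        using D(1) cl unfolding untouched_clique_def by blast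
      ultimately show "e \<in> complete_graph_edges n - (B \<union> M)"
        using D(1) cl by (auto simp: untouched_clique_def complete_graph_edges_def)
    qed
    \<comment> \<open>Edges inside \<open>C\<close> are already Breaker's, so each edge to be
      claimed has an end in the new set \<open>D\<close>.\<close>
    have "S \<subseteq> (\<lambda>(x, y). {x, y}) ` (D \<times> (C \<union> D))"
    proof
      fix e assume e: "e \<in> S"
      then obtain x y where xy: "e = {x, y}" "x \<in> C \<union> D" "y \<in> C \<union> D"
        by (auto simp: S_def card_2_iff)
      have "\<not> e \<subseteq> C"
        using e cl by (auto simp: S_def untouched_clique_def)
      with xy have "(x, y) \<in> D \<times> (C \<union> D) \<or> (y, x) \<in> D \<times> (C \<union> D)"
        by blast
      with xy(1) show "e \<in> (\<lambda>(x, y). {x, y}) ` (D \<times> (C \<union> D))"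
        by (auto simp: insert_commute)
    qed
    then have "card S \<le> card (D \<times> (C \<union> D))"
      using finC finD by (intro surj_card_le) auto
    also have "\<dots> = (a + 1) * (card C + 1 + a)"
      using D(2) cardCD by (simp add: card_cartesian_product)
    also have "\<dots> \<le> (a + 1) * (k + a)"
      using \<open>card C + 1 \<le> k\<close> by (intro mult_le_mono2) simp
    finally show "card S \<le> b"
      using bias by simp
  next
    fix T assume T: "T \<subseteq> complete_graph_edges n - (B \<union> M \<union> S)" "card T \<le> a"
    have "untouched_clique n (C \<union> D) (B \<union> S) M"
      using cl D(1) by (auto simp: untouched_clique_def S_def)
    moreover have "T \<subseteq> complete_graph_edges n - (B \<union> S)"
      using T(1) by blast
    moreover have "card C + 1 + a \<le> card (C \<union> D)"
      using cardCD by simp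
    ultimately obtain C' where
      C': "card C' = card C + 1" "untouched_clique n C' (B \<union> S) (M \<union> T)"
      using untouched_clique_after_maker_turn T(2) by metis
    show "isolates n a b (B \<union> S) (M \<union> T)"
    proof (rule Suc.IH[OF C'(2)])
      show "card C' + d = k"
        using C'(1) Suc.prems(2) by simp
      show "M \<union> T \<subseteq> complete_graph_edges n"
        using T(1) Suc.prems(3) by blast
      show "card (M \<union> T) \<le> a * card C'"
        using card_Un_le[of M T] T(2) Suc.prems(4) C'(1) by simp
    qed
  qed
qed

text \<open>Chains the stages into three inequalities: the clique is built up to
  \<open>a * m + 1\<close> vertices, then the box game runs for \<open>m\<close> rounds and a final
  turn. Boxes are bounded by \<open>n\<close>.\<close>

theorem breaker_wins_connectivity_criterion:
  assumes "0 < a" "0 < b" "2 \<le> n"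
    and "(a + 1) * (a * m + 1 + a) \<le> b" "(2 * a + 1) * (a * m + 1) + a \<le> n"
    and "n \<le> b + (\<Sum>i=1..m. b div (a * i + 1))"
  shows "breaker_wins_connectivity a b n"
proof -
  have "isolates n a b {} {}"
  proof (rule clique_stage[where C = "{}" and d = "a * m + 1" and k = "a * m + 1"])
    fix C B M
    assume "untouched_clique n C B M" "card C = a * m + 1"
    then show "isolates n a b B M"
    proof (rule box_stage)
      show "card (star n v - B) \<le> n" for v
        using card_star_le[of n v] card_mono[of "star n v" "star n v - B"] by simp
    qed (use assms in simp)
  qed (use assms in \<open>auto simp: untouched_clique_def\<close>)
  then obtain \<sigma> where \<sigma>: "legal_strategy (complete_graph_edges n) b \<sigma>"
    and win: "\<And>\<tau>. legal_strategy (complete_graph_edges n) a \<tau> \<Longrightarrow>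
      \<exists>A\<in>star n ` {..<n}. A \<inter> maker_edges \<sigma> \<tau> = {}"
    using forced_win_strategy[of "complete_graph_edges n" "star n ` {..<n}" a b] assms(1,2)
    by auto
  have "\<not> connected_spanning {..<n} (maker_edges \<sigma> \<tau>)"
    if \<tau>: "legal_strategy (complete_graph_edges n) a \<tau>" for \<tau>
  proof -
    obtain v where "v < n" "star n v \<inter> maker_edges \<sigma> \<tau> = {}"
      using win[OF \<tau>] by auto
    moreover have "maker_edges \<sigma> \<tau> \<subseteq> complete_graph_edges n"
      using \<tau> by (auto simp: maker_edges_def legal_strategy_def free_edges_def)
    ultimately show ?thesis
      using isolated_not_connected \<open>2 \<le> n\<close> by blast
  qed
  with \<sigma> show ?thesis
    by (auto simp: breaker_wins_connectivity_def)
qed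

section \<open>Estimates\<close>

text \<open>The left side is the integral of \<open>1 / x\<close> from \<open>2\<close> to
  \<open>m + 2\<close>. In the induction one more term adds \<open>ln (1 + 1 / (m + 2))\<close>, and
  \<open>ln (1 + x) \<le> x\<close>.\<close>

lemma sum_inverse_ge_ln: "ln ((real m + 2) / 2) \<le> (\<Sum>i=1..m. 1 / (real i + 1))"
proof (induction m)
  case (Suc m)
  have "(real (Suc m) + 2) / 2 = (real m + 2) / 2 * (1 + 1 / (real m + 2))"
    by (simp add: divide_simps)
  then have "ln ((real (Suc m) + 2) / 2) = ln ((real m + 2) / 2 * (1 + 1 / (real m + 2)))"
    by (rule arg_cong)
  also have "\<dots> = ln ((real m + 2) / 2) + ln (1 + 1 / (real m + 2))"
    by (rule ln_mult_pos) (simp_all add: add_pos_pos)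
  also have "ln (1 + 1 / (real m + 2)) \<le> 1 / (real m + 2)"
    by (rule ln_add_one_self_le_self) simp
  finally show ?case
    using Suc.IH by (simp add: add.commute)
qed simp

text \<open>Bounding \<open>a * i + 1\<close> by \<open>a * (i + 1)\<close> extracts the factor
  \<open>b / a\<close> from a harmonic sum; rounding down costs at most 1 per term, hence
  \<open>m\<close> in all.\<close>

lemma box_sum_ge:
  assumes "0 < a"
  shows "real b / real a * ln ((real m + 2) / 2) - real m \<le> real (\<Sum>i=1..m. b div (a * i + 1))"
proof -
  have "real b / real a * ln ((real m + 2) / 2) - real m
      \<le> real b / real a * (\<Sum>i=1..m. 1 / (real i + 1)) - real m"
    using sum_inverse_ge_ln[of m] by (intro diff_right_mono mult_left_mono) auto
  also have "\<dots> = (\<Sum>i=1..m. real b / (real a * (real i + 1)) - 1)"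
    by (simp add: sum_distrib_left sum_subtractf)
  also have "\<dots> \<le> (\<Sum>i=1..m. real (b div (a * i + 1)))"
  proof (rule sum_mono)
    fix i
    have "real (a * i + 1) \<le> real a * (real i + 1)"
      using assms by (simp add: algebra_simps)
    then have "real b / (real a * (real i + 1)) \<le> real b / real (a * i + 1)"
      by (intro divide_left_mono mult_pos_pos) (use assms in \<open>auto intro: add_pos_nonneg\<close>)
    also have "\<dots> \<le> real (b div (a * i + 1)) + 1"
      using floor_divide_of_nat_eq[of b "a * i + 1", where ?'a = real] by linarith
    finally show "real b / (real a * (real i + 1)) - 1 \<le> real (b div (a * i + 1))"
      by simp
  qed
  finally show ?thesis by simp
qed

theorem theorem1p1:
  fixes \<epsilon> :: real
  assumes "\<epsilon> > 0"
  shows "\<exists>n0::nat. \<forall>n\<ge>n0. \<forall>a b :: nat.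
    a > 0 \<longrightarrow> b > 0 \<longrightarrow> real a \<le> ln (real n) \<longrightarrow>
    real b \<ge> (1 + \<epsilon>) * (real a * real n / ln (real a * real n)) \<longrightarrow>
    breaker_wins_connectivity a b n"
proof -
  \<comment> \<open>The conditions of the criterion with \<open>a\<close> replaced by its largest
    value \<open>ln n\<close>, and \<open>ln (a n)\<close> by \<open>ln n + ln (ln n)\<close>. With
    \<open>L = ln n\<close>, the clique conditions compare orders \<open>n / L^2\<close> with
    \<open>n / L\<close> and with \<open>n\<close>. In the last fact the right side is
    asymptotically \<open>(1 + \<epsilon>) n\<close>, while rounding costs only
    \<open>n / L^4\<close>.\<close>
  have "\<forall>\<^sub>F n in sequentially. 2 \<le> n \<and> 1 \<le> ln (real n) \<and> 0 \<le> ln (ln (real n)) \<and>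
      2 \<le> real n / ln (real n) ^ 4"
    by (intro eventually_conj eventually_ge_at_top; real_asymp)
  moreover have "\<forall>\<^sub>F n in sequentially. (ln (real n) + 1) *
      (ln (real n) * (real n / ln (real n) ^ 4) + 1 + ln (real n)) \<le>
      real n / (ln (real n) + ln (ln (real n)))"
    by real_asymp
  moreover have "\<forall>\<^sub>F n in sequentially.
      (2 * ln (real n) + 1) * (ln (real n) * (real n / ln (real n) ^ 4) + 1) + ln (real n) \<le> real n"
    by real_asymp
  moreover have "\<forall>\<^sub>F n in sequentially. real n + real n / ln (real n) ^ 4 \<le>
      (1 + \<epsilon>) * (real n / (ln (real n) + ln (ln (real n)))) * ln (real n / ln (real n) ^ 4 / 2)"
    using assms by real_asymp
  ultimately have "\<forall>\<^sub>F n in sequentially. \<forall>a b :: nat.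
    a > 0 \<longrightarrow> b > 0 \<longrightarrow> real a \<le> ln (real n) \<longrightarrow>
    real b \<ge> (1 + \<epsilon>) * (real a * real n / ln (real a * real n)) \<longrightarrow>
    breaker_wins_connectivity a b n"
  proof eventually_elim
    case (elim n)
    show ?case
    proof (intro allI impI)
      fix a b :: nat
      assume a: "0 < a" "real a \<le> ln (real n)" and b: "0 < b"
        "(1 + \<epsilon>) * (real a * real n / ln (real a * real n)) \<le> real b"
      define L where "L = ln (real n)"
      \<comment> \<open>Dividing by \<open>L ^ 4\<close> keeps the clique cheap to build, yet
        \<open>ln x\<close> is still asymptotically \<open>L\<close>, so the harmonic sum loses no
        constant factor.\<close>
      define x where "x = real n / L ^ 4"
      define m where "m = nat \<lfloor>x\<rfloor>"
      have L: "1 \<le> L" "0 \<le> ln L" "2 \<le> x" and n: "2 \<le> n"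
        using elim(1) by (auto simp: L_def x_def)
      have aL: "1 \<le> real a" "real a \<le> L"
        using a by (auto simp: L_def)
      have mx: "real m \<le> x" "x \<le> real m + 2"
        using L(3) unfolding m_def by linarith+
      have am: "real a * real m \<le> L * x"
        using aL mx(1) by (intro mult_mono) auto
      have ln_an: "ln (real a * real n) = ln (real a) + L"
        using a n by (simp add: ln_mult L_def)
      have "0 < ln (real a * real n)"
        unfolding ln_an using L(1) aL(1) by (simp add: add_nonneg_pos)
      moreover have "ln (real a * real n) \<le> L + ln L"
        unfolding ln_an using aL by simp
      ultimately have "real n / (L + ln L) \<le> real n / ln (real a * real n)"
        by (intro divide_left_mono) auto
      then have "(1 + \<epsilon>) * (real n / (L + ln L)) * real a
          \<le> (1 + \<epsilon>) * (real n / ln (real a * real n)) * real a"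
        using assms by (intro mult_right_mono mult_left_mono) auto
      also have "\<dots> \<le> real b"
        using b(2) by (simp add: mult_ac)
      \<comment> \<open>This lower bound on \<open>b / a\<close> no longer depends on
        \<open>a\<close>, so facts about \<open>n\<close> alone finish the estimates.\<close>
      finally have ba: "(1 + \<epsilon>) * (real n / (L + ln L)) \<le> real b / real a"
        using aL(1) by (simp add: pos_le_divide_eq)
      show "breaker_wins_connectivity a b n"
      proof (rule breaker_wins_connectivity_criterion[where m = m])
        have "(real a + 1) * (real a * real m + 1 + real a) \<le> (L + 1) * (L * x + 1 + L)"
          using aL am by (intro mult_mono add_mono am) auto
        also have "\<dots> \<le> real n / (L + ln L)"
          using elim(2) by (simp add: L_def x_def)
        also have "\<dots> \<le> (1 + \<epsilon>) * (real n / (L + ln L))"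
          using assms L(1,2) mult_right_mono[of 1 "1 + \<epsilon>" "real n / (L + ln L)"] by simp
        also have "\<dots> \<le> real b / real a"
          by (fact ba)
        also have "\<dots> \<le> real b"
          using divide_left_mono[of 1 "real a" "real b"] aL(1) by simp
        finally have "real ((a + 1) * (a * m + 1 + a)) \<le> real b"
          by (simp add: algebra_simps)
        then show "(a + 1) * (a * m + 1 + a) \<le> b"
          by (simp only: of_nat_le_iff)
      next
        have "(2 * real a + 1) * (real a * real m + 1) + real a \<le> (2 * L + 1) * (L * x + 1) + L"
          using aL am by (intro mult_mono add_mono am) auto
        also have "\<dots> \<le> real n"
          using elim(3) by (simp add: L_def x_def)
        finally have "real ((2 * a + 1) * (a * m + 1) + a) \<le> real n"
          by (simp add: algebra_simps)
        then show "(2 * a + 1) * (a * m + 1) + a \<le> n"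
          by (simp only: of_nat_le_iff)
      next
        have "real n + real m \<le> real n + x"
          using mx(1) by simp
        also have "\<dots> \<le> (1 + \<epsilon>) * (real n / (L + ln L)) * ln (x / 2)"
          using elim(4) by (simp add: L_def x_def)
        \<comment> \<open>Rounding \<open>x\<close> down to \<open>m\<close> is absorbed by the
          shift in \<open>m + 2\<close>; \<open>2 \<le> x\<close> keeps the logarithm
          nonnegative.\<close>
        also have "\<dots> \<le> real b / real a * ln ((real m + 2) / 2)"
          using ba mx(2) L(3) by (intro mult_mono) auto
        finally have "real n \<le> real (\<Sum>i=1..m. b div (a * i + 1))"
          using box_sum_ge[OF a(1), of b m] by linarith
        then show "n \<le> b + (\<Sum>i=1..m. b div (a * i + 1))"
          by (simp only: of_nat_le_iff)
      qed (use a b n in auto)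
    qed
  qed
  then show ?thesis
    by (simp add: eventually_sequentially)
qed

end
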